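(* Let $(X_1,d_1)$ and $(X_2,d_2)$ be metric spaces, let $\psi\in\mathbf{\Psi}_2$, and let $X:=X_1\times X_2$ be equipped with the metric $d_\psi$. Let $T:X\to X$ be given by $T(x_1,x_2):=(T_1(x_1,x_2),T_2(x_1,x_2))$ for all $(x_1,x_2)\in X$, where $T_1:X\to X_1$ and $T_2:X\to X_2$. Let $$\lambda:=2\psi\left(\tfrac12,\tfrac12\right),\qquad \theta:=(1+\lambda)\,\psi\left(\frac{\lambda}{\lambda+1},\frac{1}{\lambda+1}\right).$$ Suppose that the following conditions are satisfied: (i) $X_1$ has the fixed point property for nonexpansive maps; (ii) $X_2$ has the fixed point property for Lipschitz continuous maps with constant $\theta$; (iii) $T$ is a nonexpansive map (with respect to $d_\psi$) such that $$d_1(T_1(x_1,x_2),T_1(x'_1,x'_2))<\frac{\lambda}{\theta}\cdot d_\psi((x_1,x_2),(x'_1,x'_2))$$ for all $(x_1,x_2),(x'_1,x'_2)\in X$ with $x_1\ne x'_1$ and $x_2\ne x'_2$. Then $T$ has a fixed point.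
   Context: Let $\Omega_2:=\{(t_1,t_2)\in\mathbb{R}^2 \mid t_1,t_2\ge 0,\ t_1+t_2=1\}$. The class $\mathbf{\Psi}_2$ consists of all continuous convex functions $\psi:\Omega_2\to\mathbb{R}$ with $\psi(1,0)=\psi(0,1)=1$ such that for all $(t_1,t_2)\in\Omega_2$: $\psi(t_1,t_2)\ge(1-t_1)\,\psi\left(0,\frac{t_2}{1-t_1}\right)$ if $t_1<1$, and $\psi(t_1,t_2)\ge(1-t_2)\,\psi\left(\frac{t_1}{1-t_2},0\right)$ if $t_2<1$. For metric spaces $(X_1,d_1)$, $(X_2,d_2)$ and $\psi\in\mathbf{\Psi}_2$, the metric $d_\psi$ on $X_1\times X_2$ is defined by $d_\psi(x,y):=0$ if $x=y$ and, for $x=(x_1,x_2)\ne y=(y_1,y_2)$, with $D:=d_1(x_1,y_1)+d_2(x_2,y_2)$, $$d_\psi(x,y):=D\cdot\psi\left(\frac{d_1(x_1,y_1)}{D},\frac{d_2(x_2,y_2)}{D}\right).$$ A map $f:X\to Y$ between metric spaces is Lipschitz continuous with constant $\theta>0$ if $d(f(x),f(x'))\le\theta\, d(x,x')$ for all $x,x'\in X$; nonexpansive if this holds with $\theta=1$. A metric space has the fixed point property for a property $P$ if every self-map of the space possessing property $P$ admits a fixed point (a point $\bar x$ with $f(\bar x)=\bar x$). *)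

theory Defs
  imports "HOL-Analysis.Analysis"
begin

definition Omega2 :: "(real \<times> real) set" where
  "Omega2 = {(t1, t2). 0 \<le> t1 \<and> 0 \<le> t2 \<and> t1 + t2 = 1}"

text \<open>Only the values on \<^const>\<open>Omega2\<close> matter; a function in \<open>Psi2\<close> is arbitrary elsewhere.\<close>

definition Psi2 :: "(real \<times> real \<Rightarrow> real) set" where
  "Psi2 = {\<psi>. continuous_on Omega2 \<psi> \<and> convex_on Omega2 \<psi> \<and>
     \<psi> (1, 0) = 1 \<and> \<psi> (0, 1) = 1 \<and>
     (\<forall>(t1, t2) \<in> Omega2.
        (t1 < 1 \<longrightarrow> \<psi> (t1, t2) \<ge> (1 - t1) * \<psi> (0, t2 / (1 - t1))) \<and>
        (t2 < 1 \<longrightarrow> \<psi> (t1, t2) \<ge> (1 - t2) * \<psi> (t1 / (1 - t2), 0)))}"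

definition dpsi ::
  "('a \<Rightarrow> 'a \<Rightarrow> real) \<Rightarrow> ('b \<Rightarrow> 'b \<Rightarrow> real) \<Rightarrow> (real \<times> real \<Rightarrow> real)
    \<Rightarrow> 'a \<times> 'b \<Rightarrow> 'a \<times> 'b \<Rightarrow> real" where
  "dpsi d1 d2 \<psi> x y =
     (if x = y then 0
      else let D = d1 (fst x) (fst y) + d2 (snd x) (snd y)
           in D * \<psi> (d1 (fst x) (fst y) / D, d2 (snd x) (snd y) / D))"

text \<open>
  Metric spaces are given by a carrier and a distance function, as in the locale
  \<^locale>\<open>Metric_space\<close>, because the product carries the distance \<^const>\<open>dpsi\<close>
  rather than the Euclidean one of the type class instance. Maps are total functions
  whose values outside the carrier are irrelevant.
\<close>

definition Lipschitz_with ::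
  "real \<Rightarrow> 'a set \<Rightarrow> ('a \<Rightarrow> 'a \<Rightarrow> real) \<Rightarrow> 'b set \<Rightarrow> ('b \<Rightarrow> 'b \<Rightarrow> real)
    \<Rightarrow> ('a \<Rightarrow> 'b) \<Rightarrow> bool" where
  "Lipschitz_with \<theta> X d Y e f \<longleftrightarrow>
     0 < \<theta> \<and> f \<in> X \<rightarrow> Y \<and> (\<forall>x\<in>X. \<forall>x'\<in>X. e (f x) (f x') \<le> \<theta> * d x x')"

definition nonexpansive_map ::
  "'a set \<Rightarrow> ('a \<Rightarrow> 'a \<Rightarrow> real) \<Rightarrow> 'b set \<Rightarrow> ('b \<Rightarrow> 'b \<Rightarrow> real)
    \<Rightarrow> ('a \<Rightarrow> 'b) \<Rightarrow> bool" where
  "nonexpansive_map X d Y e f \<longleftrightarrow> Lipschitz_with 1 X d Y e f"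

definition fixed_point_property :: "'a set \<Rightarrow> (('a \<Rightarrow> 'a) \<Rightarrow> bool) \<Rightarrow> bool" where
  "fixed_point_property X P \<longleftrightarrow> (\<forall>f. f \<in> X \<rightarrow> X \<and> P f \<longrightarrow> (\<exists>x\<in>X. f x = x))"

end

theory Submission
  imports Defs
begin

text \<open>
  A function \<open>\<psi>\<close> in \<^const>\<open>Psi2\<close> extends by homogeneity to a gauge
  \<open>N a b = (a + b) * \<psi> (a / (a + b), b / (a + b))\<close> on the quadrant, and \<^const>\<open>dpsi\<close> is
  \<open>N\<close> applied to the two coordinate distances. Convexity of \<open>\<psi>\<close> makes \<open>N\<close> subadditive, and the
  two inequalities in the definition of \<^const>\<open>Psi2\<close> say that \<open>N\<close> dominates each of its arguments;
  together they give monotonicity in each argument. In these terms \<open>\<theta> = N \<lambda> 1\<close>.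

  Freeze \<open>y\<close> in the second factor. As \<open>N\<close> dominates its first argument and \<open>N a 0 = a\<close>, the map
  \<open>x \<mapsto> T1 (x, y)\<close> is nonexpansive, so it has a fixed point \<open>f y\<close>. Put \<open>a = d1 (f y) (f y')\<close> and
  \<open>b = d2 y y'\<close> for two points with \<open>f y \<noteq> f y'\<close>. The strict inequality assumed of \<open>T1\<close> reads
  \<open>\<theta> * a < \<lambda> * N a b\<close>. It forces \<open>a \<le> \<lambda> * b\<close>: by homogeneity it amounts to
  \<open>N 1 (1 / \<lambda>) < N 1 (b / a)\<close>, and monotonicity excludes \<open>b / a \<le> 1 / \<lambda>\<close>. If
  \<open>f y = f y'\<close>, then \<open>a = 0\<close> and \<open>a \<le> \<lambda> * b\<close> is trivial. Therefore
  \<open>N a b \<le> N (\<lambda> * b) b = \<theta> * b\<close>, so that the map \<open>y \<mapsto> T2 (f y, y)\<close> is Lipschitz with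
  constant \<open>\<theta>\<close>, although \<open>f\<close> comes from an arbitrary choice of fixed points. A fixed point \<open>y\<close>
  of this map yields the fixed point \<open>(f y, y)\<close> of \<open>T\<close>.
\<close>

definition gauge_ext :: "(real \<times> real \<Rightarrow> real) \<Rightarrow> real \<Rightarrow> real \<Rightarrow> real" where
  "gauge_ext \<psi> a b = (a + b) * \<psi> (a / (a + b), b / (a + b))"

lemma gauge_ext_zero [simp]: "gauge_ext \<psi> 0 0 = 0"
  by (simp add: gauge_ext_def)

lemma gauge_ext_axis:
  assumes "\<psi> \<in> Psi2"
  shows "gauge_ext \<psi> a 0 = a" "gauge_ext \<psi> 0 b = b"
  using assms by (cases "a = 0"; cases "b = 0"; simp add: gauge_ext_def Psi2_def)+

lemma gauge_ext_scale:
  assumes "0 \<le> k"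
  shows "gauge_ext \<psi> (k * a) (k * b) = k * gauge_ext \<psi> a b"
proof (cases "k = 0")
  case False
  have "k * a + k * b = k * (a + b)"
    by (simp add: distrib_left)
  then show ?thesis
    using False by (simp add: gauge_ext_def)
qed simp

lemma normalized_in_Omega2:
  assumes "0 \<le> a" "0 \<le> b" "a + b \<noteq> 0"
  shows "(a / (a + b), b / (a + b)) \<in> Omega2"
  using assms by (auto simp: Omega2_def add_divide_distrib[symmetric])

text \<open>
  The normalisation of a sum of two vectors is the convex combination of their normalisations
  with weights proportional to their coordinate sums, so this is convexity of \<open>\<psi>\<close> made
  homogeneous.
\<close>

lemma gauge_ext_subadditive:
  assumes "\<psi> \<in> Psi2" and "0 \<le> a" "0 \<le> b" "0 \<le> c" "0 \<le> d"
  shows "gauge_ext \<psi> (a + c) (b + d) \<le> gauge_ext \<psi> a b + gauge_ext \<psi> c d"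
proof (cases "a + b = 0 \<or> c + d = 0")
  case True
  then have "a = 0 \<and> b = 0 \<or> c = 0 \<and> d = 0"
    using assms by linarith
  then show ?thesis
    by auto
next
  case False
  define s where "s = a + b"
  define r where "r = c + d"
  have pos: "0 < s" "0 < r"
    using False assms unfolding s_def r_def by linarith+
  define w where "w = r / (s + r)"
  define p where "p = (a / s, b / s)"
  define q where "q = (c / r, d / r)"
  have w: "0 \<le> w" "w \<le> 1" "(s + r) * (1 - w) = s" "(s + r) * w = r"
    using pos by (auto simp: w_def field_simps)
  have u: "1 - w = s / (s + r)"
    using pos by (simp add: w_def field_simps)
  have "p \<in> Omega2" "q \<in> Omega2"
    unfolding p_def q_def s_def r_def using assms False by (auto intro: normalized_in_Omega2)
  moreover have "convex_on Omega2 \<psi>"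
    using assms(1) by (simp add: Psi2_def)
  ultimately have "\<psi> ((1 - w) *\<^sub>R p + w *\<^sub>R q) \<le> (1 - w) * \<psi> p + w * \<psi> q"
    using w by (intro convex_onD) auto
  moreover have "(1 - w) *\<^sub>R p + w *\<^sub>R q = ((a + c) / (s + r), (b + d) / (s + r))"
    using pos unfolding u by (simp add: p_def q_def w_def add_divide_distrib)
  ultimately have "(s + r) * \<psi> ((a + c) / (s + r), (b + d) / (s + r))
      \<le> (s + r) * ((1 - w) * \<psi> p + w * \<psi> q)"
    using pos by simp
  also have "\<dots> = ((s + r) * (1 - w)) * \<psi> p + ((s + r) * w) * \<psi> q"
    by (simp only: distrib_left mult.assoc)
  also have "\<dots> = s * \<psi> p + r * \<psi> q"
    by (simp only: w)
  finally show ?thesis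
    by (simp add: gauge_ext_def p_def q_def s_def r_def add.assoc add.left_commute)
qed

text \<open>
  The two lower bounds in \<^const>\<open>Psi2\<close> compare \<open>\<psi>\<close> with its values at the corners, after
  rescaling; as these values are \<open>1\<close>, they read \<open>t2 \<le> \<psi> (t1, t2)\<close> and \<open>t1 \<le> \<psi> (t1, t2)\<close>.
\<close>

lemma Psi2_lower_bounds:
  assumes "\<psi> \<in> Psi2" and "(t1, t2) \<in> Omega2"
  shows "t1 \<le> \<psi> (t1, t2)" "t2 \<le> \<psi> (t1, t2)"
proof -
  have t: "0 \<le> t1" "0 \<le> t2" "t2 = 1 - t1"
    using assms(2) by (auto simp: Omega2_def)
  have corners: "\<psi> (1, 0) = 1" "\<psi> (0, 1) = 1"
    using assms(1) by (auto simp: Psi2_def)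
  have low: "t1 < 1 \<longrightarrow> (1 - t1) * \<psi> (0, t2 / (1 - t1)) \<le> \<psi> (t1, t2)"
    "t2 < 1 \<longrightarrow> (1 - t2) * \<psi> (t1 / (1 - t2), 0) \<le> \<psi> (t1, t2)"
    using assms by (auto simp: Psi2_def)
  show "t1 \<le> \<psi> (t1, t2)"
    using low(2) t corners by (cases "t2 = 1") auto
  show "t2 \<le> \<psi> (t1, t2)"
    using low(1) t corners by (cases "t1 = 1") auto
qed

lemma gauge_ext_dominates:
  assumes "\<psi> \<in> Psi2" and "0 \<le> a" "0 \<le> b"
  shows "a \<le> gauge_ext \<psi> a b" "b \<le> gauge_ext \<psi> a b"
proof -
  have "a \<le> gauge_ext \<psi> a b \<and> b \<le> gauge_ext \<psi> a b"
  proof (cases "a + b = 0")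
    case True
    then show ?thesis
      using assms by (simp add: add_nonneg_eq_0_iff)
  next
    case False
    then have pos: "0 < a + b"
      using assms by linarith
    have "(a / (a + b), b / (a + b)) \<in> Omega2"
      using assms False by (intro normalized_in_Omega2)
    from Psi2_lower_bounds[OF assms(1) this] show ?thesis
      using pos by (simp add: gauge_ext_def pos_divide_le_eq mult.commute)
  qed
  then show "a \<le> gauge_ext \<psi> a b" "b \<le> gauge_ext \<psi> a b"
    by auto
qed

lemma gauge_ext_quasiconvex:
  assumes "\<psi> \<in> Psi2" and "0 \<le> t" "t \<le> 1" "0 \<le> a" "0 \<le> b" "0 \<le> c" "0 \<le> d"
    and le: "gauge_ext \<psi> a b \<le> gauge_ext \<psi> c d"
  shows "gauge_ext \<psi> ((1 - t) * a + t * c) ((1 - t) * b + t * d) \<le> gauge_ext \<psi> c d"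
proof -
  have "gauge_ext \<psi> ((1 - t) * a + t * c) ((1 - t) * b + t * d)
      \<le> gauge_ext \<psi> ((1 - t) * a) ((1 - t) * b) + gauge_ext \<psi> (t * c) (t * d)"
    using assms by (intro gauge_ext_subadditive) auto
  also have "\<dots> = (1 - t) * gauge_ext \<psi> a b + t * gauge_ext \<psi> c d"
    using assms by (simp add: gauge_ext_scale)
  also have "\<dots> \<le> (1 - t) * gauge_ext \<psi> c d + t * gauge_ext \<psi> c d"
    using assms by (intro add_right_mono mult_left_mono) auto
  finally show ?thesis
    by (simp add: algebra_simps)
qed

text \<open>
  To raise one coordinate, move along the segment that starts on the axis where this coordinate
  vanishes. The gauge at the starting point is the other coordinate, which is dominated by the
  gauge at the far end, so quasiconvexity applies to every point in between.
\<close>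

lemma gauge_ext_mono:
  assumes "\<psi> \<in> Psi2" and "0 \<le> a" "a \<le> a'" "0 \<le> b" "b \<le> b'"
  shows "gauge_ext \<psi> a b \<le> gauge_ext \<psi> a' b'"
proof -
  have nonneg: "0 \<le> a'" "0 \<le> b'"
    using assms by linarith+
  have "gauge_ext \<psi> a b \<le> gauge_ext \<psi> a' b"
  proof (cases "a' = 0")
    case False
    have "gauge_ext \<psi> 0 b \<le> gauge_ext \<psi> a' b"
      using assms nonneg by (simp add: gauge_ext_axis gauge_ext_dominates)
    from gauge_ext_quasiconvex[OF assms(1) _ _ _ _ _ _ this, of "a / a'"] show ?thesis
      using assms nonneg False by (simp add: left_diff_distrib)
  qed (use assms in simp)
  also have "gauge_ext \<psi> a' b \<le> gauge_ext \<psi> a' b'"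
  proof (cases "b' = 0")
    case False
    have "gauge_ext \<psi> a' 0 \<le> gauge_ext \<psi> a' b'"
      using assms nonneg by (simp add: gauge_ext_axis gauge_ext_dominates)
    from gauge_ext_quasiconvex[OF assms(1) _ _ _ _ _ _ this, of "b / b'"] show ?thesis
      using assms nonneg False by (simp add: left_diff_distrib)
  qed (use assms in simp)
  finally show ?thesis .
qed

lemma dpsi_eq_gauge_ext:
  assumes "Metric_space X1 d1" "Metric_space X2 d2"
    and "x1 \<in> X1" "x2 \<in> X2"
  shows "dpsi d1 d2 \<psi> (x1, x2) (y1, y2) = gauge_ext \<psi> (d1 x1 y1) (d2 x2 y2)"
  using Metric_space.mdist_zero[OF assms(1,3)] Metric_space.mdist_zero[OF assms(2,4)]
  by (auto simp: dpsi_def gauge_ext_def Let_def)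

text \<open>
  This is where the two constants \<open>\<lambda>\<close> and \<open>\<theta> = gauge_ext \<psi> \<lambda> 1\<close> meet: on the line \<open>a = \<lambda> * b\<close>
  the two sides of the strict inequality are equal, and beyond that line the quotient
  \<open>gauge_ext \<psi> a b / a\<close> cannot be larger, because it depends monotonically on \<open>b / a\<close>.
\<close>

lemma slope_bound:
  assumes "\<psi> \<in> Psi2" and "0 < l" "0 \<le> a" "0 \<le> b"
    and strict: "gauge_ext \<psi> l 1 * a < l * gauge_ext \<psi> a b"
  shows "a \<le> l * b"
proof (rule ccontr)
  assume "\<not> a \<le> l * b"
  then have "l * gauge_ext \<psi> a b = gauge_ext \<psi> (l * a) (l * b)" "l * b \<le> a"
    using assms by (simp_all add: gauge_ext_scale)
  then have "l * gauge_ext \<psi> a b \<le> gauge_ext \<psi> (a * l) (a * 1)"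
    using assms by (simp add: mult.commute gauge_ext_mono)
  also have "\<dots> = gauge_ext \<psi> l 1 * a"
    using gauge_ext_scale[OF \<open>0 \<le> a\<close>, of \<psi> l 1] by (simp only: mult.commute)
  finally show False
    using strict by simp
qed

theorem theorem4p4:
  fixes X1 :: "'a set" and d1 :: "'a \<Rightarrow> 'a \<Rightarrow> real"
    and X2 :: "'b set" and d2 :: "'b \<Rightarrow> 'b \<Rightarrow> real"
    and \<psi> :: "real \<times> real \<Rightarrow> real"
    and T :: "'a \<times> 'b \<Rightarrow> 'a \<times> 'b"
    and T1 :: "'a \<times> 'b \<Rightarrow> 'a" and T2 :: "'a \<times> 'b \<Rightarrow> 'b"
    and lam \<theta> :: real
  assumes "Metric_space X1 d1" and "Metric_space X2 d2"
    and "\<psi> \<in> Psi2"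
    and "T1 \<in> X1 \<times> X2 \<rightarrow> X1" and "T2 \<in> X1 \<times> X2 \<rightarrow> X2"
    and "\<forall>x1\<in>X1. \<forall>x2\<in>X2. T (x1, x2) = (T1 (x1, x2), T2 (x1, x2))"
    and "lam = 2 * \<psi> (1 / 2, 1 / 2)"
    and "\<theta> = (1 + lam) * \<psi> (lam / (lam + 1), 1 / (lam + 1))"
    and "fixed_point_property X1 (nonexpansive_map X1 d1 X1 d1)"
    and "fixed_point_property X2 (Lipschitz_with \<theta> X2 d2 X2 d2)"
    and "nonexpansive_map (X1 \<times> X2) (dpsi d1 d2 \<psi>) (X1 \<times> X2) (dpsi d1 d2 \<psi>) T"
    and "\<forall>x1\<in>X1. \<forall>x2\<in>X2. \<forall>x1'\<in>X1. \<forall>x2'\<in>X2. x1 \<noteq> x1' \<and> x2 \<noteq> x2' \<longrightarrow>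
           d1 (T1 (x1, x2)) (T1 (x1', x2')) < lam / \<theta> * dpsi d1 d2 \<psi> (x1, x2) (x1', x2')"
  shows "\<exists>x \<in> X1 \<times> X2. T x = x"
proof -
  interpret M1: Metric_space X1 d1 by fact
  interpret M2: Metric_space X2 d2 by fact
  note psi = \<open>\<psi> \<in> Psi2\<close>
  note T_eq = \<open>\<forall>x1\<in>X1. \<forall>x2\<in>X2. T (x1, x2) = (T1 (x1, x2), T2 (x1, x2))\<close>
  let ?N = "gauge_ext \<psi>"
  have T1_in: "T1 (x, y) \<in> X1" and T2_in: "T2 (x, y) \<in> X2" if "x \<in> X1" "y \<in> X2" for x y
    using assms(4,5) that by auto
  have lam_N: "lam = ?N 1 1"
    using assms(7) by (simp add: gauge_ext_def)
  have lam: "1 \<le> lam"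
    unfolding lam_N using psi by (intro gauge_ext_dominates) auto
  have theta_N: "\<theta> = ?N lam 1"
    using assms(8) by (simp add: gauge_ext_def add.commute)
  have theta: "1 \<le> \<theta>"
    unfolding theta_N using psi lam by (intro gauge_ext_dominates) auto
  have nonexp: "?N (d1 (T1 (x, y)) (T1 (x', y'))) (d2 (T2 (x, y)) (T2 (x', y')))
      \<le> ?N (d1 x x') (d2 y y')"
    if "x \<in> X1" "y \<in> X2" "x' \<in> X1" "y' \<in> X2" for x y x' y'
  proof -
    have "dpsi d1 d2 \<psi> (T (x, y)) (T (x', y')) \<le> dpsi d1 d2 \<psi> (x, y) (x', y')"
      using assms(11) that by (simp add: nonexpansive_map_def Lipschitz_with_def)
    then show ?thesis
      using that T_eq T1_in T2_in
      by (simp add: dpsi_eq_gauge_ext[OF assms(1,2)])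
  qed
  have "\<exists>x\<in>X1. T1 (x, y) = x" if y: "y \<in> X2" for y
  proof -
    have "d1 (T1 (x, y)) (T1 (x', y)) \<le> d1 x x'" if x: "x \<in> X1" "x' \<in> X1" for x x'
    proof -
      have "d1 (T1 (x, y)) (T1 (x', y))
          \<le> ?N (d1 (T1 (x, y)) (T1 (x', y))) (d2 (T2 (x, y)) (T2 (x', y)))"
        using psi by (intro gauge_ext_dominates) auto
      also have "\<dots> \<le> ?N (d1 x x') (d2 y y)"
        using nonexp x y by blast
      finally show ?thesis
        using psi y by (simp add: gauge_ext_axis)
    qed
    then have "nonexpansive_map X1 d1 X1 d1 (\<lambda>x. T1 (x, y))"
      using T1_in y by (auto simp: nonexpansive_map_def Lipschitz_with_def)
    then show ?thesis
      using assms(9) T1_in y by (auto simp: fixed_point_property_def)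
  qed
  then obtain f where f: "f y \<in> X1" "T1 (f y, y) = f y" if "y \<in> X2" for y
    by metis
  define g where "g y = T2 (f y, y)" for y
  have g_in: "g \<in> X2 \<rightarrow> X2"
    using T2_in f by (auto simp: g_def)
  have "d2 (g y) (g y') \<le> \<theta> * d2 y y'" if y: "y \<in> X2" "y' \<in> X2" for y y'
  proof -
    define a where "a = d1 (f y) (f y')"
    define b where "b = d2 y y'"
    have nonneg: "0 \<le> a" "0 \<le> b"
      by (simp_all add: a_def b_def)
    (* the strict inequality is available only when both coordinates differ; otherwise a = 0 *)
    have "a \<le> lam * b"
    proof (cases "f y = f y' \<or> y = y'")
      case True
      then have "a = 0"
        using f y by (auto simp: a_def)
      then show ?thesis
        using lam nonneg by simp
    next
      case False
      then have "a < lam / \<theta> * ?N a b"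
        using assms(12) f y by (metis a_def b_def dpsi_eq_gauge_ext[OF assms(1,2)])
      then have "?N lam 1 * a < lam * ?N a b"
        using theta by (simp add: theta_N[symmetric] field_simps)
      then show ?thesis
        using slope_bound psi lam nonneg by simp
    qed
    have "d2 (g y) (g y') \<le> ?N (d1 (T1 (f y, y)) (T1 (f y', y'))) (d2 (g y) (g y'))"
      using psi by (intro gauge_ext_dominates) auto
    also have "\<dots> \<le> ?N a b"
      unfolding a_def b_def g_def using f y by (intro nonexp) auto
    also have "\<dots> \<le> ?N (b * lam) (b * 1)"
      using psi nonneg \<open>a \<le> lam * b\<close> by (intro gauge_ext_mono) (auto simp: mult.commute)
    also have "\<dots> = \<theta> * b"
      using gauge_ext_scale[OF nonneg(2), of \<psi> lam 1] by (simp only: theta_N mult.commute)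
    finally show ?thesis
      by (simp add: b_def)
  qed
  then have "Lipschitz_with \<theta> X2 d2 X2 d2 g"
    using theta g_in by (simp add: Lipschitz_with_def)
  then obtain y where "y \<in> X2" "g y = y"
    using assms(10) g_in by (auto simp: fixed_point_property_def)
  then show ?thesis
    using f T_eq by (intro bexI[of _ "(f y, y)"]) (auto simp: g_def)
qed

end
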